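(* Let $E$ be a finite-dimensional real vector space, $Q\subset E$ nonempty, convex and compact, and $h:Q\to\mathbb{R}$ concave and differentiable on $Q$, with finite curvature constant $C_{h,Q}$. Run the Frank-Wolfe method with dynamic step-sizes with an initial estimate $C_0>0$ of $C_{h,Q}$. Then for any $k\ge1$ (such that $B_i>h(\lambda_i)$ for $i=1,\ldots,k$): $$B_k-h(\lambda_k)\le\min_{\ell\in\{1,\ldots,k\}}\left\{\frac{2C_k}{\frac{2C_k}{B_\ell-h(\lambda_\ell)}+k-\ell}\right\}.$$ Furthermore, if the doubling strategy is used to update the estimates $\{C_k\}$ of $C_{h,Q}$, then $C_k\le\max\{C_0,2C_{h,Q}\}$.
   Context: Notation: $E^*$ is the dual space of $E$, $s^T\lambda$ is the evaluation of $s\in E^*$ at $\lambda\in E$, $\nabla h(\lambda)\in E^*$, and $h^*=\max_{\lambda\in Q}h(\lambda)$. Curvature constant: $C_{h,Q}$ is the minimal $C$ such that $h(\lambda+\alpha(\bar\lambda-\lambda))\ge h(\lambda)+\nabla h(\lambda)^T(\alpha(\bar\lambda-\lambda))-\frac12 C\alpha^2$ for all $\lambda,\bar\lambda\in Q$ and all $\alpha\in[0,1]$ (assumed finite). Frank-Wolfe method with dynamic step-sizes: start at $\lambda_1\in Q$, with an initial estimate $C_0$ of $C_{h,Q}$ and an upper bound $B_0\ge h^*$ (possibly $+\infty$). At iteration $k\ge1$: (1) choose $\tilde\lambda_k\in\arg\max_{\lambda\in Q}\{h(\lambda_k)+\nabla h(\lambda_k)^T(\lambda-\lambda_k)\}$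 and set $B^w_k=h(\lambda_k)+\nabla h(\lambda_k)^T(\tilde\lambda_k-\lambda_k)$; (2) set $B_k=\min\{B_{k-1},B^w_k,B^o_k\}$, where $B^o_k\ge h^*$ is any other (optional) upper bound on $h^*$ (omitted, or $+\infty$, if not computed); (3) compute $C_k$ satisfying (i) $C_k\ge C_{k-1}$ and (ii) $h(\lambda_k+\bar\alpha_k(\tilde\lambda_k-\lambda_k))\ge h(\lambda_k)+\bar\alpha_k(B_k-h(\lambda_k))-\frac12C_k\bar\alpha_k^2$, where $\bar\alpha_k:=\frac{2}{\frac{2C_k}{B_k-h(\lambda_k)}+2}$ (so $\bar\alpha_k$ depends on $C_k$); (4) set $\lambda_{k+1}=\lambda_k+\bar\alpha_k(\tilde\lambda_k-\lambda_k)$. Doubling strategy: in step (3), $C_k$ is the first value in the list $C_{k-1},2C_{k-1},4C_{k-1},8C_{k-1},\ldots$ for which (ii) holds. *)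

theory Defs
  imports "HOL-Analysis.Analysis"
begin

(* The dual space of 'a is the type 'a \<Rightarrow>\<^sub>L real of bounded linear functionals (in finite dimension
   these are all linear functionals), so s^T x is blinfun_apply s x.  The derivative is taken
   within Q because h is a function on Q only.  Where Q has empty interior the functional need not
   be unique, but its values on the differences y - x with x, y in the convex set Q, the only
   values used below, are. *)
definition is_gradient_on :: "'a::real_normed_vector set \<Rightarrow> ('a \<Rightarrow> real) \<Rightarrow> ('a \<Rightarrow> ('a \<Rightarrow>\<^sub>L real)) \<Rightarrow> bool"
  where "is_gradient_on Q h grad \<longleftrightarrow>
    (\<forall>x\<in>Q. (h has_derivative blinfun_apply (grad x)) (at x within Q))"

definition max_value :: "'a set \<Rightarrow> ('a \<Rightarrow> real) \<Rightarrow> real"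
  where "max_value Q h = (GREATEST m. m \<in> h ` Q)"

definition curvature_bound ::
  "'a::real_normed_vector set \<Rightarrow> ('a \<Rightarrow> real) \<Rightarrow> ('a \<Rightarrow> ('a \<Rightarrow>\<^sub>L real)) \<Rightarrow> real \<Rightarrow> bool"
  where "curvature_bound Q h grad C \<longleftrightarrow>
    (\<forall>x\<in>Q. \<forall>y\<in>Q. \<forall>\<alpha>\<in>{0..1}.
      h (x + \<alpha> *\<^sub>R (y - x)) \<ge> h x + grad x (\<alpha> *\<^sub>R (y - x)) - 1 / 2 * C * \<alpha>\<^sup>2)"

definition finite_curvature ::
  "'a::real_normed_vector set \<Rightarrow> ('a \<Rightarrow> real) \<Rightarrow> ('a \<Rightarrow> ('a \<Rightarrow>\<^sub>L real)) \<Rightarrow> bool"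
  where "finite_curvature Q h grad \<longleftrightarrow> (\<exists>C. curvature_bound Q h grad C)"

(* Meaningful only under finite_curvature; the minimum is then attained. *)
definition curvature_constant ::
  "'a::real_normed_vector set \<Rightarrow> ('a \<Rightarrow> real) \<Rightarrow> ('a \<Rightarrow> ('a \<Rightarrow>\<^sub>L real)) \<Rightarrow> real"
  where "curvature_constant Q h grad = (LEAST C. curvature_bound Q h grad C)"

definition linear_model ::
  "('a::real_normed_vector \<Rightarrow> real) \<Rightarrow> ('a \<Rightarrow> ('a \<Rightarrow>\<^sub>L real)) \<Rightarrow> 'a \<Rightarrow> 'a \<Rightarrow> real"
  where "linear_model h grad x y = h x + grad x (y - x)"

(* The dynamic step-size; g is the optimality gap bound B_k - h(lambda_k), and the formula is
   meaningful only for g > 0. *)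
definition dyn_step :: "real \<Rightarrow> real \<Rightarrow> real"
  where "dyn_step C g = 2 / (2 * C / g + 2)"

(* Condition (ii) on the estimate C, at the iterate x with linear maximizer x' and bound b. *)
definition sufficient_increase ::
  "('a::real_normed_vector \<Rightarrow> real) \<Rightarrow> 'a \<Rightarrow> 'a \<Rightarrow> real \<Rightarrow> real \<Rightarrow> bool"
  where "sufficient_increase h x x' b C \<longleftrightarrow>
    (let \<alpha> = dyn_step C (b - h x)
     in h (x + \<alpha> *\<^sub>R (x' - x)) \<ge> h x + \<alpha> * (b - h x) - 1 / 2 * C * \<alpha>\<^sup>2)"

(* The first k iterations.  Bounds are extended reals since B 0 and the optional bounds Bo i may be
   infinite (Bo i = \<infinity> if none is computed).  For i \<ge> 1 the bound B i is finite, lying between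
   the maximum of h and the linear-model value, so real_of_ereal does not alter it. *)
definition fw_dynamic_run ::
  "'a::real_normed_vector set \<Rightarrow> ('a \<Rightarrow> real) \<Rightarrow> ('a \<Rightarrow> ('a \<Rightarrow>\<^sub>L real)) \<Rightarrow> (nat \<Rightarrow> ereal) \<Rightarrow>
    (nat \<Rightarrow> ereal) \<Rightarrow> (nat \<Rightarrow> real) \<Rightarrow> (nat \<Rightarrow> 'a) \<Rightarrow> (nat \<Rightarrow> 'a) \<Rightarrow> nat \<Rightarrow> bool"
  where "fw_dynamic_run Q h grad B Bo C lam lamt k \<longleftrightarrow>
    lam 1 \<in> Q \<and> ereal (max_value Q h) \<le> B 0 \<and>
    (\<forall>i\<in>{1..k}.
      is_arg_max (linear_model h grad (lam i)) (\<lambda>x. x \<in> Q) (lamt i) \<and>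
      ereal (max_value Q h) \<le> Bo i \<and>
      B i = min (B (i - 1)) (min (ereal (linear_model h grad (lam i) (lamt i))) (Bo i)) \<and>
      C (i - 1) \<le> C i \<and>
      sufficient_increase h (lam i) (lamt i) (real_of_ereal (B i)) (C i) \<and>
      lam (i + 1) =
        lam i + dyn_step (C i) (real_of_ereal (B i) - h (lam i)) *\<^sub>R (lamt i - lam i))"

definition doubling_strategy ::
  "('a::real_normed_vector \<Rightarrow> real) \<Rightarrow> (nat \<Rightarrow> ereal) \<Rightarrow> (nat \<Rightarrow> real) \<Rightarrow> (nat \<Rightarrow> 'a) \<Rightarrow>
    (nat \<Rightarrow> 'a) \<Rightarrow> nat \<Rightarrow> bool"
  where "doubling_strategy h B C lam lamt k \<longleftrightarrow>
    (\<forall>i\<in>{1..k}. \<exists>j. C i = 2 ^ j * C (i - 1) \<and>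
      sufficient_increase h (lam i) (lamt i) (real_of_ereal (B i)) (2 ^ j * C (i - 1)) \<and>
      (\<forall>m<j. \<not> sufficient_increase h (lam i) (lamt i) (real_of_ereal (B i)) (2 ^ m * C (i - 1))))"

end

(* With g_i = B_i - h(lambda_i), the step size is alpha_i = g_i / (C_i + g_i), and the
   sufficient-increase condition together with B_{i+1} \<le> B_i yields
   1 / g_{i+1} \<ge> 1 / g_i + 1 / (2 C_i); since C_i \<le> C_k, summing from l to k-1 gives the gap bound.
   Any positive C \<ge> C_{h,Q} satisfies the sufficient-increase condition, because the gradient
   slope towards the linear maximizer is B^w_i - h(lambda_i) \<ge> g_i.  Hence doubling never starts
   from a value \<ge> C_{h,Q}. *)

theory Submission
  imports Defs
begin

lemma dyn_step_eq:
  assumes "C > 0" and "g > 0"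
  shows "dyn_step C g = g / (C + g)"
  using assms by (simp add: dyn_step_def field_simps)

lemma dyn_step_bounds:
  assumes "C > 0" and "g > 0"
  shows "dyn_step C g \<in> {0..1}"
  using assms by (simp add: dyn_step_eq)

text \<open>Lowering the bound from \<open>b\<close> to \<open>b'\<close> only shrinks the new gap,
  which is therefore at most g - \<alpha> g + C \<alpha>^2 / 2. This is dominated by 2 C g / (2 C +
  g), whose reciprocal splits exactly into 1 / g + 1 / (2 C). Reciprocals thus make the recursion
  additive.\<close>

lemma sufficient_increase_inverse_gap:
  assumes "C > 0" and "b > h x" and inc: "sufficient_increase h x x' b C"
    and "b' \<le> b" and "b' > h (x + dyn_step C (b - h x) *\<^sub>R (x' - x))"
  shows "1 / (b' - h (x + dyn_step C (b - h x) *\<^sub>R (x' - x))) \<ge> 1 / (b - h x) + 1 / (2 * C)"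
proof -
  define g where "g = b - h x"
  define g' where "g' = b' - h (x + dyn_step C g *\<^sub>R (x' - x))"
  have g: "g > 0" "g' > 0" using assms by (auto simp: g_def g'_def)
  have "g' \<le> g - dyn_step C g * g + 1 / 2 * C * (dyn_step C g)\<^sup>2"
    using inc \<open>b' \<le> b\<close> by (auto simp: sufficient_increase_def Let_def g_def g'_def)
  also have "\<dots> = C * g * (C + 3 / 2 * g) / (C + g)\<^sup>2"
    using g(1) \<open>C > 0\<close>
    by (simp add: dyn_step_eq divide_simps add_pos_pos power2_eq_square) (simp add: algebra_simps)
  also have "\<dots> \<le> 2 * C * g / (2 * C + g)"
  proof -
    \<comment> \<open>Expanded, the right side exceeds the left by exactly g^2 / 2.\<close>
    have "(C + 3 / 2 * g) * (2 * C + g) \<le> 2 * (C + g)\<^sup>2"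
      using zero_le_power2[of g] by (simp add: power2_eq_square algebra_simps)
    then have "(C * g) * ((C + 3 / 2 * g) * (2 * C + g)) \<le> (C * g) * (2 * (C + g)\<^sup>2)"
      using g(1) \<open>C > 0\<close> by (intro mult_left_mono) auto
    then show ?thesis
      using g(1) \<open>C > 0\<close> by (simp add: pos_divide_le_eq pos_le_divide_eq mult_ac)
  qed
  finally have "g' \<le> 2 * C * g / (2 * C + g)" .
  then have "1 / (2 * C * g / (2 * C + g)) \<le> 1 / g'"
    using g by (intro divide_left_mono) (use \<open>C > 0\<close> in \<open>auto intro!: mult_pos_pos divide_pos_pos add_pos_pos\<close>)
  moreover have "1 / (2 * C * g / (2 * C + g)) = 1 / g + 1 / (2 * C)"
    using g(1) \<open>C > 0\<close> by (simp add: field_simps)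
  ultimately show ?thesis by (simp add: g_def g'_def)
qed

lemma curvature_bound_mono:
  assumes "curvature_bound Q h grad C" and "C \<le> C'"
  shows "curvature_bound Q h grad C'"
  unfolding curvature_bound_def
proof (intro ballI)
  fix x y \<alpha> assume xy: "x \<in> Q" "y \<in> Q" "\<alpha> \<in> {0..1::real}"
  have "C * \<alpha>\<^sup>2 \<le> C' * \<alpha>\<^sup>2" using assms(2) by (intro mult_right_mono) auto
  moreover have "h (x + \<alpha> *\<^sub>R (y - x)) \<ge> h x + grad x (\<alpha> *\<^sub>R (y - x)) - 1 / 2 * C * \<alpha>\<^sup>2"
    using assms(1) xy unfolding curvature_bound_def by blast
  ultimately show "h (x + \<alpha> *\<^sub>R (y - x)) \<ge> h x + grad x (\<alpha> *\<^sub>R (y - x)) - 1 / 2 * C' * \<alpha>\<^sup>2"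
    by linarith
qed

lemma curvature_bound_nonneg:
  assumes "curvature_bound Q h grad C" and "Q \<noteq> {}"
  shows "C \<ge> 0"
proof -
  obtain x where "x \<in> Q" using assms(2) by blast
  moreover have "(1::real) \<in> {0..1}" by simp
  ultimately have "h (x + 1 *\<^sub>R (x - x)) \<ge> h x + grad x (1 *\<^sub>R (x - x)) - 1 / 2 * C * 1\<^sup>2"
    using assms(1) unfolding curvature_bound_def by blast
  then show ?thesis by simp
qed

text \<open>The \<open>LEAST\<close> in the definition is a genuine minimum: the admissible
  constants form a nonempty set, bounded below by 0, and closed as an intersection of sets cut out
  by non-strict inequalities affine in C. Hence the infimum is attained.\<close>

lemma curvature_bound_curvature_constant:
  assumes "finite_curvature Q h grad" and "Q \<noteq> {}"
  shows "curvature_bound Q h grad (curvature_constant Q h grad)"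
proof -
  define S where "S = {C. curvature_bound Q h grad C}"
  have "S \<noteq> {}" using assms(1) by (auto simp: S_def finite_curvature_def)
  moreover have bdd: "bdd_below S"
    using curvature_bound_nonneg[OF _ assms(2)] by (intro bdd_belowI[of _ 0]) (simp add: S_def)
  moreover have "closed S"
  proof -
    have "S = (\<Inter>x\<in>Q. \<Inter>y\<in>Q. \<Inter>\<alpha>\<in>{0..1}.
        {C. h x + grad x (\<alpha> *\<^sub>R (y - x)) - 1 / 2 * C * \<alpha>\<^sup>2 \<le> h (x + \<alpha> *\<^sub>R (y - x))})"
      by (auto simp: S_def curvature_bound_def)
    then show ?thesis by (auto intro!: closed_INT closed_Collect_le continuous_intros)
  qed
  ultimately have "Inf S \<in> S" by (rule closed_contains_Inf)
  moreover have "curvature_constant Q h grad = Inf S"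
    unfolding curvature_constant_def
    using \<open>Inf S \<in> S\<close> cInf_lower[OF _ bdd] by (intro Least_equality) (auto simp: S_def)
  ultimately show ?thesis by (simp add: S_def)
qed

lemma curvature_bound_sufficient_increase:
  assumes "curvature_bound Q h grad C" and "C > 0" and "x \<in> Q" and "x' \<in> Q"
    and "b > h x" and "b \<le> linear_model h grad x x'"
  shows "sufficient_increase h x x' b C"
proof -
  define \<alpha> where "\<alpha> = dyn_step C (b - h x)"
  have \<alpha>: "\<alpha> \<in> {0..1}" using dyn_step_bounds[of C "b - h x"] assms by (simp add: \<alpha>_def)
  then have "h (x + \<alpha> *\<^sub>R (x' - x)) \<ge> h x + grad x (\<alpha> *\<^sub>R (x' - x)) - 1 / 2 * C * \<alpha>\<^sup>2"
    using assms unfolding curvature_bound_def by blast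
  \<comment> \<open>The upper bound on \<open>b\<close> enters here: the slope towards
    \<open>x'\<close> is at least b - h x, and scaling by \<alpha> preserves this since \<alpha> is
    nonnegative.\<close>
  moreover have "\<alpha> * (b - h x) \<le> \<alpha> * grad x (x' - x)"
    using assms(6) \<alpha> by (intro mult_left_mono) (auto simp: linear_model_def)
  ultimately show ?thesis
    by (simp add: sufficient_increase_def \<alpha>_def[symmetric] Let_def blinfun.scaleR_right)
qed

theorem mainTheorem8:
  fixes basis :: "'a::real_normed_vector set"
    and Q :: "'a set"
    and h :: "'a \<Rightarrow> real"
    and grad :: "'a \<Rightarrow> ('a \<Rightarrow>\<^sub>L real)"
    and B Bo :: "nat \<Rightarrow> ereal"
    and C :: "nat \<Rightarrow> real"
    and lam lamt :: "nat \<Rightarrow> 'a"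
    and k :: nat
  assumes "finite_dimensional_vector_space (scaleR :: real \<Rightarrow> 'a \<Rightarrow> 'a) basis"
    and "Q \<noteq> {}" and "convex Q" and "compact Q"
    and "concave_on Q h"
    and "is_gradient_on Q h grad"
    and "finite_curvature Q h grad"
    and "C 0 > 0"
    and "k \<ge> 1"
    and "fw_dynamic_run Q h grad B Bo C lam lamt k"
    and "\<forall>i\<in>{1..k}. B i > ereal (h (lam i))"
  shows "real_of_ereal (B k) - h (lam k) \<le>
      (MIN l\<in>{1..k}.
        2 * C k / (2 * C k / (real_of_ereal (B l) - h (lam l)) + (real k - real l))) \<and>
    (doubling_strategy h B C lam lamt k \<longrightarrow>
      C k \<le> max (C 0) (2 * curvature_constant Q h grad))"
proof -
  define b where "b i = real_of_ereal (B i)" for i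
  define g where "g i = b i - h (lam i)" for i
  have lam1: "lam 1 \<in> Q"
    using assms(10) by (simp add: fw_dynamic_run_def)
  have argmax: "is_arg_max (linear_model h grad (lam i)) (\<lambda>x. x \<in> Q) (lamt i)"
    and B_step: "B i = min (B (i - 1)) (min (ereal (linear_model h grad (lam i) (lamt i))) (Bo i))"
    and C_mono: "C (i - 1) \<le> C i"
    and inc: "sufficient_increase h (lam i) (lamt i) (b i) (C i)"
    and lam_step: "lam (i + 1) = lam i + dyn_step (C i) (g i) *\<^sub>R (lamt i - lam i)"
    if "i \<in> {1..k}" for i
    using assms(10) that unfolding fw_dynamic_run_def b_def g_def by blast+
  have lamt: "lamt i \<in> Q" if "i \<in> {1..k}" for i
    using argmax[OF that] by (simp add: is_arg_max_def)
  have B_le: "B i \<le> ereal (linear_model h grad (lam i) (lamt i))" if "i \<in> {1..k}" for i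
    using B_step[OF that] by (metis min.cobounded1 min.cobounded2 order.trans)
  \<comment> \<open>\<open>real_of_ereal\<close> sends infinite values to 0, so finiteness must come
    first: the linear model bounds \<open>B i\<close> above and \<open>h (lam i)\<close> bounds it
    below.\<close>
  have B_real: "B i = ereal (b i)" if "i \<in> {1..k}" for i
    using B_le[OF that] bspec[OF assms(11) that] by (cases "B i") (simp_all add: b_def)
  have g_pos: "g i > 0" if "i \<in> {1..k}" for i
    using bspec[OF assms(11) that] B_real[OF that] by (simp add: g_def)
  have C_le: "C i \<le> C j" if "i \<le> j" "j \<le> k" for i j
    using that
  proof (induction j rule: dec_induct)
    case (step n)
    then show ?case using C_mono[of "Suc n"] by simp
  qed simp
  have C_pos: "C i > 0" if "i \<le> k" for i
    using C_le[of 0 i] that assms(8) by simp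
  have inverse_gap_step: "1 / g (Suc i) \<ge> 1 / g i + 1 / (2 * C k)" if "1 \<le> i" "i < k" for i
  proof -
    have i: "i \<in> {1..k}" "Suc i \<in> {1..k}" using that by auto
    have "B (Suc i) \<le> B i" using B_step[OF i(2)] by simp
    then have "b (Suc i) \<le> b i" using B_real[OF i(1)] B_real[OF i(2)] by simp
    then have "1 / g (Suc i) \<ge> 1 / g i + 1 / (2 * C i)"
      using sufficient_increase_inverse_gap[OF C_pos _ inc[OF i(1)], of "b (Suc i)"]
        that g_pos[OF i(1)] g_pos[OF i(2)] lam_step[OF i(1)] by (simp add: g_def)
    \<comment> \<open>Passing to the final, largest estimate makes the increment independent of i,
      so that the steps can be summed.\<close>
    moreover have "1 / (2 * C k) \<le> 1 / (2 * C i)"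
      using C_le[of i k] C_pos[of i] that by (intro divide_left_mono) auto
    ultimately show ?thesis by linarith
  qed
  have inverse_gap: "1 / g j \<ge> 1 / g l + (real j - real l) / (2 * C k)"
    if "1 \<le> l" "l \<le> j" "j \<le> k" for l j
    using that(2,3)
  proof (induction j rule: dec_induct)
    case (step n)
    have "1 / g l + (real (Suc n) - real l) / (2 * C k)
        = (1 / g l + (real n - real l) / (2 * C k)) + 1 / (2 * C k)"
      by (simp add: diff_divide_distrib add_divide_distrib)
    also have "\<dots> \<le> 1 / g (Suc n)"
      using step inverse_gap_step[of n] that(1) by simp
    finally show ?case .
  qed simp
  have gap: "g k \<le> 2 * C k / (2 * C k / g l + (real k - real l))" if "l \<in> {1..k}" for l
  proof -
    have pos: "g k > 0" "g l > 0" "C k > 0" using g_pos[of k] g_pos[OF that] C_pos assms(9) by auto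
    \<comment> \<open>The summed lower bound for 1 / g k. It is positive because k - l is
      nonnegative; inverting it and extending the fraction by 2 C k gives the claimed form.\<close>
    define u where "u = 1 / g l + (real k - real l) / (2 * C k)"
    have "u > 0" using pos that by (auto simp: u_def intro!: add_pos_nonneg)
    moreover have "u \<le> 1 / g k" using inverse_gap[of l k] that by (simp add: u_def)
    ultimately have "g k \<le> 1 / u" using pos by (simp add: field_simps)
    also have "1 / u = 2 * C k / (2 * C k * u)" using pos by simp
    also have "2 * C k * u = 2 * C k / g l + (real k - real l)"
      using pos by (simp add: u_def distrib_left)
    finally show ?thesis .
  qed
  have "g k \<le> (MIN l\<in>{1..k}. 2 * C k / (2 * C k / g l + (real k - real l)))"
    using gap assms(9) by (subst Min_ge_iff) auto
  moreover have "C k \<le> max (C 0) (2 * curvature_constant Q h grad)"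
    if dbl: "doubling_strategy h B C lam lamt k"
  proof -
    let ?K = "curvature_constant Q h grad"
    \<comment> \<open>The curvature inequality is available only at points of Q. Iterates stay there
      as convex combinations, the step size lying in [0, 1].\<close>
    have lam_in: "lam i \<in> Q" if "1 \<le> i" "i \<le> k" for i
      using that
    proof (induction i rule: dec_induct)
      case (step n)
      then have n: "n \<in> {1..k}" "lam n \<in> Q" by auto
      define \<alpha> where "\<alpha> = dyn_step (C n) (g n)"
      have "\<alpha> \<in> {0..1}" unfolding \<alpha>_def using C_pos g_pos n by (intro dyn_step_bounds) auto
      then have "(1 - \<alpha>) *\<^sub>R lam n + \<alpha> *\<^sub>R lamt n \<in> Q"
        using convexD_alt[OF assms(3) n(2) lamt[OF n(1)]] by simp
      moreover have "lam (Suc n) = (1 - \<alpha>) *\<^sub>R lam n + \<alpha> *\<^sub>R lamt n"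
        using lam_step[OF n(1)] by (simp add: \<alpha>_def algebra_simps)
      ultimately show ?case by simp
    qed (use lam1 in simp)
    \<comment> \<open>Positivity of c is a separate condition because the curvature constant may be
      0, for example for affine h.\<close>
    have suff: "sufficient_increase h (lam i) (lamt i) (b i) c"
      if "i \<in> {1..k}" "c > 0" "?K \<le> c" for i c
    proof (rule curvature_bound_sufficient_increase)
      show "curvature_bound Q h grad c"
        using curvature_bound_mono curvature_bound_curvature_constant assms(2,7) that(3) by blast
      show "b i \<le> linear_model h grad (lam i) (lamt i)"
        using B_le[OF that(1)] B_real[OF that(1)] by simp
    qed (use that lam_in lamt g_pos[of i] in \<open>auto simp: g_def\<close>)
    have "C i \<le> max (C 0) (2 * ?K)" if "i \<le> k" for i
      using that
    proof (induction i)
      case (Suc i)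
      then have i: "Suc i \<in> {1..k}" by auto
      obtain j where j: "C (Suc i) = 2 ^ j * C i"
        and least: "\<forall>m<j. \<not> sufficient_increase h (lam (Suc i)) (lamt (Suc i)) (b (Suc i)) (2 ^ m * C i)"
        using dbl i unfolding doubling_strategy_def b_def by (metis diff_Suc_1)
      show ?case
      proof (cases j)
        case 0
        then show ?thesis using j Suc by simp
      next
        case (Suc m)
        \<comment> \<open>The last rejected candidate is half of the accepted one. By
          \<open>suff\<close> its rejection forces it below the curvature constant, so the accepted
          value is below twice that constant. With j = 0 the estimate is simply inherited.\<close>
        have "2 ^ m * C i > 0" using C_pos[of i] \<open>Suc i \<le> k\<close> by simp
        then have "2 ^ m * C i < ?K" using least suff[OF i] Suc by (meson lessI not_less)
        then show ?thesis using j Suc by simp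
      qed
    qed simp
    then show ?thesis by simp
  qed
  ultimately show ?thesis by (simp add: g_def b_def)
qed

end
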